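(* Let $\mathcal V$ be a variety with $2$ Gumm terms. Then in every algebra $\mathbf A\in\mathcal V$ the following inclusions hold for all reflexive admissible relations $R,S,T,W$ on $\mathbf A$: (1) $R(S\circ T)\circ RW\subseteq RS\circ RT\circ R(\overline{S\cup T\cup W})$; (2) $R(S\circ RT)\circ RW\subseteq RS\circ RT\circ RT\circ R(\overline{S\cup W})$; (3) $R(RS\circ T)\circ RW\subseteq RS\circ RT\circ RS\circ R(\overline{T\cup W})$.
   Context: A binary relation on an algebra $\mathbf A$ is admissible if it is compatible with all operations, i.e. it is a subalgebra of $\mathbf A\times\mathbf A$. For a reflexive binary relation $X$ on $\mathbf A$, $\overline{X}$ denotes the smallest admissible relation on $\mathbf A$ containing $X$. Juxtaposition of relations denotes intersection and binds more tightly than relational composition $\circ$, where $a\,(S\circ T)\,c$ iff there is $b$ with $a\,S\,b\,T\,c$. A variety $\mathcal V$ has $2$ Gumm terms if it has ternary terms $j_1,j_2$ such that the equations $x=j_1(x,x,z)$, $j_1(x,z,z)=j_2(x,z,z)$, $j_2(x,x,z)=z$ and $x=j_1(x,y,x)$ hold in $\mathcal V$. *)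

theory Defs
  imports Main
begin

text \<open>
  A similarity type is an arity function on a type of operation symbols; all operations are
  finitary. The interpretation \<open>oper\<close> is only relevant on lists over the universe whose length
  is the arity of the symbol.
\<close>

record ('f, 'a) algebra =
  universe :: "'a set"
  oper :: "'f \<Rightarrow> 'a list \<Rightarrow> 'a"

definition is_algebra :: "('f \<Rightarrow> nat) \<Rightarrow> ('f, 'a) algebra \<Rightarrow> bool" where
  "is_algebra ar A \<longleftrightarrow> universe A \<noteq> {} \<and>
     (\<forall>f as. length as = ar f \<and> set as \<subseteq> universe A \<longrightarrow> oper A f as \<in> universe A)"

datatype ('f, 'v) trm = Var 'v | App 'f "('f, 'v) trm list"

fun wf_trm :: "('f \<Rightarrow> nat) \<Rightarrow> ('f, 'v) trm \<Rightarrow> bool" where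
  "wf_trm ar (Var v) = True"
| "wf_trm ar (App f ts) = (length ts = ar f \<and> (\<forall>t \<in> set ts. wf_trm ar t))"

fun vars_trm :: "('f, 'v) trm \<Rightarrow> 'v set" where
  "vars_trm (Var v) = {v}"
| "vars_trm (App f ts) = (\<Union>t \<in> set ts. vars_trm t)"

fun eval_trm :: "('f, 'a) algebra \<Rightarrow> ('v \<Rightarrow> 'a) \<Rightarrow> ('f, 'v) trm \<Rightarrow> 'a" where
  "eval_trm A \<sigma> (Var v) = \<sigma> v"
| "eval_trm A \<sigma> (App f ts) = oper A f (map (eval_trm A \<sigma>) ts)"

type_synonym 'f equation = "('f, nat) trm \<times> ('f, nat) trm"

definition wf_equation :: "('f \<Rightarrow> nat) \<Rightarrow> 'f equation \<Rightarrow> bool" where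
  "wf_equation ar e \<longleftrightarrow> wf_trm ar (fst e) \<and> wf_trm ar (snd e)"

definition satisfies :: "('f, 'a) algebra \<Rightarrow> 'f equation \<Rightarrow> bool" where
  "satisfies A e \<longleftrightarrow>
     (\<forall>\<sigma>. range \<sigma> \<subseteq> universe A \<longrightarrow> eval_trm A \<sigma> (fst e) = eval_trm A \<sigma> (snd e))"

text \<open>
  A variety is an equational class. HOL has no class of algebras over all types at once, so a
  variety is represented by its members with universe in a given, arbitrary type.
\<close>

definition is_variety :: "('f \<Rightarrow> nat) \<Rightarrow> ('f, 'a) algebra set \<Rightarrow> bool" where
  "is_variety ar V \<longleftrightarrow>
     (\<exists>E. (\<forall>e \<in> E. wf_equation ar e) \<and> V = {A. is_algebra ar A \<and> (\<forall>e \<in> E. satisfies A e)})"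

text \<open>A ternary term has its variables among \<open>0\<close>, \<open>1\<close>, \<open>2\<close>, in this order of arguments.\<close>

definition ternary_trm :: "('f \<Rightarrow> nat) \<Rightarrow> ('f, nat) trm \<Rightarrow> bool" where
  "ternary_trm ar t \<longleftrightarrow> wf_trm ar t \<and> vars_trm t \<subseteq> {0, 1, 2}"

definition ternary_op :: "('f, 'a) algebra \<Rightarrow> ('f, nat) trm \<Rightarrow> 'a \<Rightarrow> 'a \<Rightarrow> 'a \<Rightarrow> 'a" where
  "ternary_op A t x y z = eval_trm A (\<lambda>i. [x, y, z] ! i) t"

definition has_2_Gumm_terms :: "('f \<Rightarrow> nat) \<Rightarrow> ('f, 'a) algebra set \<Rightarrow> bool" where
  "has_2_Gumm_terms ar V \<longleftrightarrow>
     (\<exists>j1 j2. ternary_trm ar j1 \<and> ternary_trm ar j2 \<and>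
       (\<forall>A \<in> V. \<forall>x \<in> universe A. \<forall>y \<in> universe A. \<forall>z \<in> universe A.
          x = ternary_op A j1 x x z \<and>
          ternary_op A j1 x z z = ternary_op A j2 x z z \<and>
          ternary_op A j2 x x z = z \<and>
          x = ternary_op A j1 x y x))"

definition admissible :: "('f \<Rightarrow> nat) \<Rightarrow> ('f, 'a) algebra \<Rightarrow> 'a rel \<Rightarrow> bool" where
  "admissible ar A R \<longleftrightarrow> R \<subseteq> universe A \<times> universe A \<and>
     (\<forall>f ps. length ps = ar f \<and> set ps \<subseteq> R \<longrightarrow>
        (oper A f (map fst ps), oper A f (map snd ps)) \<in> R)"

definition refl_admissible :: "('f \<Rightarrow> nat) \<Rightarrow> ('f, 'a) algebra \<Rightarrow> 'a rel \<Rightarrow> bool" where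
  "refl_admissible ar A R \<longleftrightarrow> refl_on (universe A) R \<and> admissible ar A R"

definition adm_closure :: "('f \<Rightarrow> nat) \<Rightarrow> ('f, 'a) algebra \<Rightarrow> 'a rel \<Rightarrow> 'a rel" where
  "adm_closure ar A X = \<Inter>{Y. admissible ar A Y \<and> X \<subseteq> Y}"

end

theory Submission
  imports Defs
begin

text \<open>
  Write \<open>j\<close> and \<open>p\<close> for the two Gumm operations. The equations \<open>j x y x = x\<close> and \<open>j x x z = x\<close>
  make \<open>j\<close> behave like a majority operation that is anchored at its first argument, while \<open>p\<close> is
  a Maltsev operation with one law missing: instead of \<open>p x z z = x\<close> there is only
  \<open>p x z z = j x z z\<close>. The whole proof consists in choosing intermediate elements and in passing
  between the two readings of \<open>j x z z\<close>.

  Let \<open>a R d\<close>, \<open>a S b T d\<close> and let \<open>d\<close> be related to \<open>c\<close> by both \<open>R\<close> and \<open>W\<close>.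

  The first two steps. The element \<open>j a b d\<close> is reached from \<open>a\<close> by \<open>S\<close> since \<open>a = j a a d\<close> and by
  \<open>R\<close> since \<open>a = j a b a\<close>. It is \<open>T\<close>-related to \<open>j a d d\<close>. That it is also \<open>R\<close>-related to \<open>j a d d\<close>,
  although \<open>b\<close> need not be \<open>R\<close>-related to \<open>d\<close>, is where \<open>p\<close> enters: an arbitrary element \<open>e\<close> is
  \<open>p a a e\<close>, and changing the second \<open>a\<close> to \<open>d\<close> and \<open>e\<close> to \<open>d\<close> gives \<open>p a d d = j a d d\<close>; so it is
  enough that \<open>e R d\<close>. This argument can be iterated in the first argument of \<open>j\<close>
  (lemma \<open>two_steps\<close>).

  The last step. To arrive at \<open>c\<close> from \<open>p u v d\<close> in one step it suffices that \<open>u\<close> and \<open>v\<close> have a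
  common successor, by \<open>p x x c = c\<close> (lemma \<open>last_step\<close>). For \<open>R\<close> the common successor is \<open>d\<close>;
  for the admissible closure it is a different element. Here the relations are not symmetric, and
  the missing converse is replaced by the following observation (lemma \<open>back_step\<close>): if \<open>b T d\<close>,
  then \<open>d = p b b d\<close> is \<open>T\<close>-related to \<open>p b d d = j b d d\<close>, which takes the place of \<open>b\<close>. The element
  \<open>j b d d\<close> is at the same time an \<open>S\<close>-successor of \<open>j a d d\<close>, so \<open>d\<close> and \<open>j a d d\<close> have a common
  successor in the closure of \<open>S \<union> T\<close>. This gives the first inclusion, and the second one as well,
  where \<open>b R d\<close> allows the step from \<open>d\<close> to \<open>j b d d\<close> to be made in advance. In the third inclusion
  \<open>a R b\<close>, and an \<open>S\<close>-step moves from \<open>j a d d\<close> to an element \<open>p u v d\<close> for which \<open>u\<close> and \<open>v\<close> have a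
  common \<open>T\<close>-successor and the common \<open>R\<close>-successor \<open>d\<close>.
\<close>

section \<open>Two Gumm operations\<close>

text \<open>
  Only the two ternary operations and their compatibility with the relations matter, so the
  argument is carried out for abstract operations.
\<close>

locale gumm_operations =
  fixes U :: "'a set" and j p :: "'a \<Rightarrow> 'a \<Rightarrow> 'a \<Rightarrow> 'a"
  assumes j_closed: "\<lbrakk>x \<in> U; y \<in> U; z \<in> U\<rbrakk> \<Longrightarrow> j x y z \<in> U"
    and p_closed: "\<lbrakk>x \<in> U; y \<in> U; z \<in> U\<rbrakk> \<Longrightarrow> p x y z \<in> U"
    and j_xxz: "\<lbrakk>x \<in> U; z \<in> U\<rbrakk> \<Longrightarrow> j x x z = x"
    and j_xyx: "\<lbrakk>x \<in> U; y \<in> U\<rbrakk> \<Longrightarrow> j x y x = x"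
    and p_xzz: "\<lbrakk>x \<in> U; z \<in> U\<rbrakk> \<Longrightarrow> p x z z = j x z z"
    and p_xxz: "\<lbrakk>x \<in> U; z \<in> U\<rbrakk> \<Longrightarrow> p x x z = z"
begin

definition refl_compatible :: "'a rel \<Rightarrow> bool" where
  "refl_compatible R \<longleftrightarrow> R \<subseteq> U \<times> U \<and> (\<forall>x \<in> U. (x, x) \<in> R) \<and>
     (\<forall>x x' y y' z z'. (x, x') \<in> R \<and> (y, y') \<in> R \<and> (z, z') \<in> R \<longrightarrow>
        (j x y z, j x' y' z') \<in> R \<and> (p x y z, p x' y' z') \<in> R)"

lemma refl_compatibleD:
  assumes "refl_compatible R"
  shows refl_compatible_in: "(x, y) \<in> R \<Longrightarrow> x \<in> U \<and> y \<in> U"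
    and refl_compatible_refl: "x \<in> U \<Longrightarrow> (x, x) \<in> R"
    and refl_compatible_j:
      "\<lbrakk>(x, x') \<in> R; (y, y') \<in> R; (z, z') \<in> R\<rbrakk> \<Longrightarrow> (j x y z, j x' y' z') \<in> R"
    and refl_compatible_p:
      "\<lbrakk>(x, x') \<in> R; (y, y') \<in> R; (z, z') \<in> R\<rbrakk> \<Longrightarrow> (p x y z, p x' y' z') \<in> R"
  using assms unfolding refl_compatible_def by blast+

text \<open>
  The absorption law \<open>j x y x = x\<close> allows an arbitrary middle argument on both ends.
\<close>

lemma from_absorb:
  assumes "refl_compatible R" "(a, u) \<in> R" "(a, d) \<in> R" "y \<in> U"
  shows "(a, j u y d) \<in> R"
  using refl_compatible_j[OF assms(1,2) refl_compatible_refl[OF assms(1,4)] assms(3)]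
    j_xyx refl_compatible_in[OF assms(1,2)] assms(4) by simp

lemma to_absorb:
  assumes "refl_compatible R" "(u, d) \<in> R" "y \<in> U"
  shows "(j u y d, d) \<in> R"
proof -
  have d: "d \<in> U" using refl_compatible_in[OF assms(1,2)] by blast
  show ?thesis
    using refl_compatible_j[OF assms(1,2) refl_compatible_refl[OF assms(1,3)]
        refl_compatible_refl[OF assms(1) d]]
      j_xyx d assms(3) by simp
qed

text \<open>A substitute for the converse of \<open>T\<close>: the element \<open>j b d d\<close> stands in for \<open>b\<close>.\<close>

lemma back_step:
  assumes "refl_compatible T" "(b, d) \<in> T"
  shows "(d, j b d d) \<in> T"
proof -
  have in_U: "b \<in> U" "d \<in> U" using refl_compatible_in[OF assms] by blast+
  have "(p b b d, p b d d) \<in> T"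
    by (intro refl_compatible_p[OF assms(1)] refl_compatible_refl[OF assms(1)] assms(2) in_U)
  thus ?thesis using in_U by (simp add: p_xxz p_xzz)
qed

lemma last_step:
  assumes "refl_compatible Q" "(u, t) \<in> Q" "(v, t) \<in> Q" "(d, c) \<in> Q"
  shows "(p u v d, c) \<in> Q"
  using refl_compatible_p[OF assms] p_xxz refl_compatible_in[OF assms(1,2)]
    refl_compatible_in[OF assms(1,4)] by simp

text \<open>
  With \<open>u = v = a\<close> this describes the path from \<open>a\<close> through \<open>j a b d\<close> to \<open>j a d d\<close>, whose elements
  may in turn be taken as \<open>u\<close> and \<open>v\<close>. The last \<open>R\<close>-step does not compare the arguments of \<open>j\<close>, as \<open>b\<close>
  and \<open>d\<close> may be unrelated by \<open>R\<close>; it starts from \<open>e = p a a e\<close> with \<open>e = j u b d\<close>.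
\<close>

lemma two_steps:
  assumes R: "refl_compatible R" and S: "refl_compatible S" and T: "refl_compatible T"
    and ad: "(a, d) \<in> R" and ab: "(a, b) \<in> S" and bd: "(b, d) \<in> T"
    and au: "(a, u) \<in> R \<inter> S" and uv: "(u, v) \<in> T" and ud: "(u, d) \<in> R" and av: "(a, v) \<in> R"
  shows "(a, j u b d) \<in> R \<inter> S" and "(j u b d, j v d d) \<in> R \<inter> T"
proof -
  have in_U: "a \<in> U" "b \<in> U" "d \<in> U" "u \<in> U" "v \<in> U"
    using refl_compatible_in[OF R ad] refl_compatible_in[OF T bd] refl_compatible_in[OF T uv] by blast+
  have "(a, j u b d) \<in> R"
    using from_absorb[OF R _ ad] au in_U by blast
  moreover have "(j a a d, j u b d) \<in> S"
    using au by (intro refl_compatible_j[OF S] refl_compatible_refl[OF S] ab in_U) blast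
  hence "(a, j u b d) \<in> S" using in_U by (simp add: j_xxz)
  ultimately show "(a, j u b d) \<in> R \<inter> S" by blast
  have "(j u b d, d) \<in> R"
    using to_absorb[OF R ud] in_U by blast
  hence "(p a a (j u b d), p v d d) \<in> R"
    by (rule refl_compatible_p[OF R av ad])
  hence "(j u b d, j v d d) \<in> R" using in_U by (simp add: p_xxz p_xzz j_closed)
  moreover have "(j u b d, j v d d) \<in> T"
    by (intro refl_compatible_j[OF T] refl_compatible_refl[OF T] uv bd in_U)
  ultimately show "(j u b d, j v d d) \<in> R \<inter> T" by blast
qed

end

section \<open>The three paths\<close>

locale gumm_configuration = gumm_operations +
  fixes R S T W Q :: "'a rel" and a b c d :: 'a
  assumes R: "refl_compatible R" and S: "refl_compatible S" and T: "refl_compatible T"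
    and Q: "refl_compatible Q"
    and ad: "(a, d) \<in> R" and ab: "(a, b) \<in> S" and bd: "(b, d) \<in> T"
    and dc: "(d, c) \<in> R \<inter> W" and WQ: "W \<subseteq> Q"
begin

lemma in_U: "a \<in> U" "b \<in> U" "c \<in> U" "d \<in> U"
  using refl_compatible_in[OF R ad] refl_compatible_in[OF T bd] refl_compatible_in[OF R] dc by blast+

lemma first_path:
  shows "(a, j a b d) \<in> R \<inter> S" and "(j a b d, j a d d) \<in> R \<inter> T"
  using two_steps[OF R S T ad ab bd, of a a] ad in_U
    refl_compatible_refl[OF R] refl_compatible_refl[OF S] refl_compatible_refl[OF T] by blast+

lemma jabd_d: "(j a b d, d) \<in> R" and a_jadd: "(a, j a d d) \<in> R" and jadd_d: "(j a d d, d) \<in> R"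
  using to_absorb[OF R ad] from_absorb[OF R refl_compatible_refl[OF R] ad] in_U by blast+

lemma second_path:
  shows "(a, j (j a b d) b d) \<in> R \<inter> S"
    and "(j (j a b d) b d, j (j a d d) d d) \<in> R \<inter> T"
  using two_steps[OF R S T ad ab bd, of "j a b d" "j a d d"] first_path jabd_d a_jadd by blast+

lemma jadd_jbdd: "(j a d d, j b d d) \<in> S"
  by (intro refl_compatible_j[OF S] refl_compatible_refl[OF S] ab in_U)

lemma second_path_end: "j (j a d d) d d = p (j a d d) d d"
  using in_U by (simp add: p_xzz j_closed)

text \<open>
  The first path ends in \<open>p a d d\<close>, from which \<open>c\<close> could be reached if \<open>a\<close> and \<open>d\<close> had a common
  successor in \<open>Q\<close>. The second path replaces \<open>a\<close> by \<open>j a d d\<close>, and then \<open>j b d d\<close> is such a successor: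
  of \<open>j a d d\<close> by \<open>S\<close> and of \<open>d\<close> by \<open>T\<close>.
\<close>

lemma path_1:
  assumes "S \<subseteq> Q" "T \<subseteq> Q"
  shows "(a, c) \<in> (R \<inter> S) O (R \<inter> T) O (R \<inter> Q)"
proof -
  have "(p (j a d d) d d, c) \<in> R"
    using last_step[OF R jadd_d] refl_compatible_refl[OF R] dc in_U by blast
  moreover have "(p (j a d d) d d, c) \<in> Q"
    using last_step[OF Q] jadd_jbdd back_step[OF T bd] assms dc WQ by blast
  ultimately show ?thesis
    using second_path unfolding second_path_end by blast
qed

text \<open>
  If \<open>b\<close> is related to \<open>d\<close> by \<open>R\<close> as well, the step from \<open>d\<close> to \<open>j b d d\<close> can be made before the last
  step, which then has no need of \<open>T\<close>.
\<close>

lemma path_2: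
  assumes bd_R: "(b, d) \<in> R" and "S \<subseteq> Q"
  shows "(a, c) \<in> (R \<inter> S) O (R \<inter> T) O (R \<inter> T) O (R \<inter> Q)"
proof -
  let ?f = "p (j a d d) (j b d d) d"
  have step: "(p (j a d d) d d, ?f) \<in> X" if X: "refl_compatible X" and "(b, d) \<in> X" for X
    using refl_compatible_p[OF X] refl_compatible_refl[OF X] back_step[OF that] in_U j_closed
    by simp
  have "(?f, c) \<in> R"
    using last_step[OF R jadd_d] to_absorb[OF R bd_R] dc in_U by blast
  moreover have "(?f, c) \<in> Q"
  proof (rule last_step[OF Q])
    show "(j a d d, j b d d) \<in> Q" using jadd_jbdd assms by blast
    show "(j b d d, j b d d) \<in> Q" using refl_compatible_refl[OF Q] in_U j_closed by blast
    show "(d, c) \<in> Q" using dc WQ by blast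
  qed
  ultimately show ?thesis
    using second_path step[OF R bd_R] step[OF T bd] unfolding second_path_end by blast
qed

text \<open>
  If \<open>a\<close> is related to \<open>b\<close> by \<open>R\<close> as well, the first path suffices. Its end \<open>j a d d = p a d d\<close> is
  written as \<open>p (j a a d) (p a a d) d\<close>, and changing the second \<open>a\<close> of both inner terms to \<open>b\<close> makes
  the first two arguments of \<open>p\<close> meet: for \<open>T\<close> in \<open>j a d d = p a d d\<close>, and for \<open>R\<close> in \<open>d = p b b d\<close>.
\<close>

lemma path_3:
  assumes ab_R: "(a, b) \<in> R" and "T \<subseteq> Q"
  shows "(a, c) \<in> (R \<inter> S) O (R \<inter> T) O (R \<inter> S) O (R \<inter> Q)"
proof -
  let ?f = "p (j a b d) (p a b d) d"
  have start: "p (j a a d) (p a a d) d = j a d d"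
    using in_U by (simp add: j_xxz p_xxz p_xzz)
  have step: "(j a d d, ?f) \<in> X" if X: "refl_compatible X" and "(a, b) \<in> X" for X
    unfolding start[symmetric]
    by (intro refl_compatible_p[OF X] refl_compatible_j[OF X] refl_compatible_refl[OF X] that in_U)
  have "(p a b d, p b b d) \<in> R"
    by (intro refl_compatible_p[OF R] refl_compatible_refl[OF R] ab_R in_U)
  hence "(?f, c) \<in> R"
    using last_step[OF R jabd_d] p_xxz dc in_U by simp
  moreover have "(p a b d, p a d d) \<in> T"
    by (intro refl_compatible_p[OF T] refl_compatible_refl[OF T] bd in_U)
  hence "(p a b d, j a d d) \<in> T"
    using in_U by (simp add: p_xzz)
  hence "(?f, c) \<in> Q"
    using last_step[OF Q] first_path assms dc WQ by blast
  ultimately show ?thesis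
    using first_path step[OF R ab_R] step[OF S ab] by blast
qed

end

section \<open>Term operations and admissible relations\<close>

lemma admissible_eval_trm:
  assumes "admissible ar A R" "wf_trm ar t" "\<And>v. v \<in> vars_trm t \<Longrightarrow> (\<sigma> v, \<tau> v) \<in> R"
  shows "(eval_trm A \<sigma> t, eval_trm A \<tau> t) \<in> R"
  using assms(2,3)
proof (induction t)
  case (Var v)
  thus ?case by simp
next
  case (App f ts)
  let ?ps = "map (\<lambda>t. (eval_trm A \<sigma> t, eval_trm A \<tau> t)) ts"
  have "length ?ps = ar f" "set ?ps \<subseteq> R"
    using App by auto
  hence "(oper A f (map fst ?ps), oper A f (map snd ?ps)) \<in> R"
    using assms(1) unfolding admissible_def by blast
  thus ?case by (simp add: comp_def)
qed

lemma admissible_ternary_op: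
  assumes "admissible ar A R" "ternary_trm ar t"
    and "(x, x') \<in> R" "(y, y') \<in> R" "(z, z') \<in> R"
  shows "(ternary_op A t x y z, ternary_op A t x' y' z') \<in> R"
  unfolding ternary_op_def
proof (rule admissible_eval_trm[OF assms(1)])
  show "wf_trm ar t" using assms(2) by (simp add: ternary_trm_def)
next
  fix v assume "v \<in> vars_trm t"
  hence "v = 0 \<or> v = 1 \<or> v = 2" using assms(2) by (auto simp: ternary_trm_def)
  thus "([x, y, z] ! v, [x', y', z'] ! v) \<in> R" using assms(3-) by auto
qed

lemma admissible_full:
  assumes "is_algebra ar A"
  shows "admissible ar A (universe A \<times> universe A)"
  unfolding admissible_def
proof (intro conjI allI impI subset_refl)
  fix f ps assume ps: "length ps = ar f \<and> set ps \<subseteq> universe A \<times> universe A"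
  hence "set (map fst ps) \<subseteq> universe A" "set (map snd ps) \<subseteq> universe A" by auto
  thus "(oper A f (map fst ps), oper A f (map snd ps)) \<in> universe A \<times> universe A"
    using assms ps by (simp add: is_algebra_def)
qed

lemma ternary_op_closed:
  assumes "is_algebra ar A" "ternary_trm ar t" "x \<in> universe A" "y \<in> universe A" "z \<in> universe A"
  shows "ternary_op A t x y z \<in> universe A"
  using admissible_ternary_op[OF admissible_full[OF assms(1)] assms(2), of x x y y z z] assms(3-)
  by blast

lemma adm_closure_upper: "X \<subseteq> adm_closure ar A X"
  unfolding adm_closure_def by blast

text \<open>
  The full relation shows that the intersection in the closure is not over the empty family, so that
  the closure stays within the universe.
\<close>

lemma admissible_adm_closure:
  assumes "is_algebra ar A" "X \<subseteq> universe A \<times> universe A"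
  shows "admissible ar A (adm_closure ar A X)"
proof -
  have "adm_closure ar A X \<subseteq> universe A \<times> universe A"
    using admissible_full[OF assms(1)] assms(2) unfolding adm_closure_def by blast
  moreover have "(oper A f (map fst ps), oper A f (map snd ps)) \<in> adm_closure ar A X"
    if "length ps = ar f" "set ps \<subseteq> adm_closure ar A X" for f ps
    unfolding adm_closure_def
  proof (rule InterI)
    fix Y assume "Y \<in> {Y. admissible ar A Y \<and> X \<subseteq> Y}"
    moreover from this have "set ps \<subseteq> Y"
      using that(2) unfolding adm_closure_def by blast
    ultimately show "(oper A f (map fst ps), oper A f (map snd ps)) \<in> Y"
      using that(1) unfolding admissible_def by blast
  qed
  ultimately show ?thesis unfolding admissible_def by blast
qed

lemma refl_admissible_adm_closure:
  assumes "is_algebra ar A" "refl_admissible ar A S" "S \<subseteq> X" "X \<subseteq> universe A \<times> universe A"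
  shows "refl_admissible ar A (adm_closure ar A X)"
  using admissible_adm_closure[OF assms(1,4)] assms(2,3) adm_closure_upper[of X ar A]
  unfolding refl_admissible_def refl_on_def by blast

section \<open>The inclusions\<close>

theorem theorem3p5:
  fixes ar :: "'f \<Rightarrow> nat"
    and V :: "('f, 'a) algebra set"
  assumes "is_variety ar V"
    and "has_2_Gumm_terms ar V"
  shows "\<forall>A \<in> V. \<forall>R S T W.
    refl_admissible ar A R \<and> refl_admissible ar A S \<and>
    refl_admissible ar A T \<and> refl_admissible ar A W \<longrightarrow>
      (R \<inter> (S O T)) O (R \<inter> W)
        \<subseteq> (R \<inter> S) O (R \<inter> T) O (R \<inter> adm_closure ar A (S \<union> T \<union> W)) \<and>
      (R \<inter> (S O (R \<inter> T))) O (R \<inter> W)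
        \<subseteq> (R \<inter> S) O (R \<inter> T) O (R \<inter> T) O (R \<inter> adm_closure ar A (S \<union> W)) \<and>
      (R \<inter> ((R \<inter> S) O T)) O (R \<inter> W)
        \<subseteq> (R \<inter> S) O (R \<inter> T) O (R \<inter> S) O (R \<inter> adm_closure ar A (T \<union> W))"
proof (intro ballI allI impI)
  fix A and R S T W :: "'a rel"
  assume "A \<in> V"
    and "refl_admissible ar A R \<and> refl_admissible ar A S \<and>
      refl_admissible ar A T \<and> refl_admissible ar A W"
  hence R: "refl_admissible ar A R" and S: "refl_admissible ar A S"
    and T: "refl_admissible ar A T" and W: "refl_admissible ar A W" by auto
  obtain j1 j2 where j1: "ternary_trm ar j1" and j2: "ternary_trm ar j2"
    and gumm: "\<And>x y z. \<lbrakk>x \<in> universe A; y \<in> universe A; z \<in> universe A\<rbrakk> \<Longrightarrow>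
      x = ternary_op A j1 x x z \<and> ternary_op A j1 x z z = ternary_op A j2 x z z \<and>
      ternary_op A j2 x x z = z \<and> x = ternary_op A j1 x y x"
    using assms(2) \<open>A \<in> V\<close> unfolding has_2_Gumm_terms_def by blast
  have alg: "is_algebra ar A"
    using assms(1) \<open>A \<in> V\<close> unfolding is_variety_def by blast
  interpret gumm_operations "universe A" "ternary_op A j1" "ternary_op A j2"
    by unfold_locales
      (use gumm ternary_op_closed[OF alg j1] ternary_op_closed[OF alg j2] in \<open>simp_all\<close>)
  have compatible: "refl_compatible X" if "refl_admissible ar A X" for X
  proof -
    have "admissible ar A X" "X \<subseteq> universe A \<times> universe A" "\<forall>x \<in> universe A. (x, x) \<in> X"
      using that by (auto simp: refl_admissible_def refl_on_def admissible_def)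
    thus ?thesis
      by (simp add: refl_compatible_def admissible_ternary_op[OF _ j1] admissible_ternary_op[OF _ j2])
  qed
  have sub: "X \<subseteq> universe A \<times> universe A" if "refl_admissible ar A X" for X
    using that unfolding refl_admissible_def admissible_def by blast
  have closure: "refl_compatible (adm_closure ar A (X \<union> Y))"
    if "refl_admissible ar A X" "Y \<subseteq> universe A \<times> universe A" for X Y
    using refl_admissible_adm_closure[OF alg that(1), of "X \<union> Y"] that sub compatible by blast
  have configuration: "gumm_configuration (universe A) (ternary_op A j1) (ternary_op A j2) R S T W Q a b c d"
    if "(a, d) \<in> R" "(a, b) \<in> S" "(b, d) \<in> T" "(d, c) \<in> R \<inter> W" "W \<subseteq> Q" "refl_compatible Q"
    for Q a b c d
    using that compatible R S T by unfold_locales auto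
  have incl_1: "(R \<inter> (S O T)) O (R \<inter> W)
      \<subseteq> (R \<inter> S) O (R \<inter> T) O (R \<inter> adm_closure ar A (S \<union> T \<union> W))" (is "?lhs \<subseteq> ?rhs")
  proof (rule subrelI)
    fix a c assume "(a, c) \<in> ?lhs"
    then obtain b d where "(a, d) \<in> R" "(a, b) \<in> S" "(b, d) \<in> T" "(d, c) \<in> R \<inter> W" by blast
    moreover have "refl_compatible (adm_closure ar A (S \<union> T \<union> W))"
      using closure[OF S, of "T \<union> W"] sub[OF T] sub[OF W] by (simp add: Un_assoc)
    ultimately show "(a, c) \<in> ?rhs"
      using adm_closure_upper[of "S \<union> T \<union> W" ar A]
      by (intro gumm_configuration.path_1[OF configuration[where b = b and d = d]]) auto
  qed
  have incl_2: "(R \<inter> (S O (R \<inter> T))) O (R \<inter> W)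
      \<subseteq> (R \<inter> S) O (R \<inter> T) O (R \<inter> T) O (R \<inter> adm_closure ar A (S \<union> W))" (is "?lhs \<subseteq> ?rhs")
  proof (rule subrelI)
    fix a c assume "(a, c) \<in> ?lhs"
    then obtain b d where "(a, d) \<in> R" "(a, b) \<in> S" "(b, d) \<in> T" "(b, d) \<in> R" "(d, c) \<in> R \<inter> W"
      by blast
    thus "(a, c) \<in> ?rhs"
      using closure[OF S sub[OF W]] adm_closure_upper[of "S \<union> W" ar A]
      by (intro gumm_configuration.path_2[OF configuration[where b = b and d = d]]) auto
  qed
  have incl_3: "(R \<inter> ((R \<inter> S) O T)) O (R \<inter> W)
      \<subseteq> (R \<inter> S) O (R \<inter> T) O (R \<inter> S) O (R \<inter> adm_closure ar A (T \<union> W))" (is "?lhs \<subseteq> ?rhs")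
  proof (rule subrelI)
    fix a c assume "(a, c) \<in> ?lhs"
    then obtain b d where "(a, d) \<in> R" "(a, b) \<in> S" "(a, b) \<in> R" "(b, d) \<in> T" "(d, c) \<in> R \<inter> W"
      by blast
    thus "(a, c) \<in> ?rhs"
      using closure[OF T sub[OF W]] adm_closure_upper[of "T \<union> W" ar A]
      by (intro gumm_configuration.path_3[OF configuration[where b = b and d = d]]) auto
  qed
  show "(R \<inter> (S O T)) O (R \<inter> W)
        \<subseteq> (R \<inter> S) O (R \<inter> T) O (R \<inter> adm_closure ar A (S \<union> T \<union> W)) \<and>
      (R \<inter> (S O (R \<inter> T))) O (R \<inter> W)
        \<subseteq> (R \<inter> S) O (R \<inter> T) O (R \<inter> T) O (R \<inter> adm_closure ar A (S \<union> W)) \<and>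
      (R \<inter> ((R \<inter> S) O T)) O (R \<inter> W)
        \<subseteq> (R \<inter> S) O (R \<inter> T) O (R \<inter> S) O (R \<inter> adm_closure ar A (T \<union> W))"
    using incl_1 incl_2 incl_3 by blast
qed

end
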